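(* Let the system $\dot u = Lu+R(u,v,\mu,\varepsilon)=:F(u,v,\mu,\varepsilon)$, $\dot v=\varepsilon G(u,v,\mu,\varepsilon)$ satisfy the vector field, spectral decomposition and hyperbolic linear equation assumptions described in the context, with $G\in C^k(V_u\times V_v\times V_\mu\times V_\varepsilon,\mathbb R^m)$, and let $\Psi$, $O_u,O_v,O_\mu,O_\varepsilon$ and $M_c(\mu,\varepsilon)$ be the centre-manifold data described in the context. Let $T>0$, let $(\mu,\varepsilon)\in O_\mu\times O_\varepsilon$, and let $(u,v)$ be a solution of the system which belongs to $M_c(\mu,\varepsilon)$ for $t\in[0,T]$. Then $u=u_c+\Psi(u_c,v,\mu,\varepsilon)$ with $(u_c,v)$, $u_c(t)\in E_c$, satisfying $$\dot u_c=P_cF\big(u_c+\Psi(u_c,v,\mu,\varepsilon),v,\mu,\varepsilon\big),\qquad \dot v=\varepsilon G\big(u_c+\Psi(u_c,v,\mu,\varepsilon),v,\mu,\varepsilon\big).$$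
   Context: Let $m,p\in\mathbb N$ and let $Z\hookrightarrow Y\hookrightarrow X$ be Banach spaces with continuous embeddings. In the system, $u\in X$, $v\in\mathbb R^m$, $(\mu,\varepsilon)\in\mathbb R^p\times\mathbb R$ are parameters, $L:Z\to X$ is linear, $R$ takes values in $Y$ and $G$ takes values in $\mathbb R^m$. A solution on an interval $I$ is a pair $(u,v)$ with $u\in C(I,Z)\cap C^1(I,X)$ and $v\in C^1(I,\mathbb R^m)$, satisfying the first equation in $X$ and the second in $\mathbb R^m$ for all $t\in I$. The resolvent set $\rho(L)$ is the set of $\lambda\in\mathbb C$ for which $\lambda\,\mathrm{id}-L$ is invertible with $(\lambda\,\mathrm{id}-L)^{-1}\in\mathcal L(X)$ (complexify real spaces), and $\sigma(L)=\mathbb C\setminus\rho(L)$. For a Banach space $W$ and $\eta\ge0$, $C_\eta(\mathbb R,W)=\{u\in C^0(\mathbb R,W):\ \sup_{t\in\mathbb R}e^{-\eta|t|}\|u(t)\|_W<\infty\}$, with this supremum as norm. Vector field assumption: $L\in\mathcal L(Z,X)$; there are an integer $k\ge2$ and neighbourhoods $V_u\subset Z$, $V_v\subset\mathbb R^m$, $V_\mu\subset\mathbb R^p$, $V_\varepsilon\subset\mathbb R$ of $0$ such that $R\in C^k(V_u\times V_v\times V_\mu\times V_\varepsilon,Y)$, $R(0,0,0,0)=0$ and $D_uR(0,0,0,0)=0$. Spectral decomposition assumption: let $\sigma_u,\sigma_c,\sigma_s$ be the subsets of $\sigma(L)$ of elements with positive, zero, negative real part respectively. Then $\sigma_c$ consists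 of a finite number $n>0$ of eigenvalues with finite algebraic multiplicities, and there is $\gamma>0$ with $\inf_{\lambda\in\sigma_u}\mathrm{Re}\,\lambda>\gamma$ and $\sup_{\lambda\in\sigma_s}\mathrm{Re}\,\lambda<-\gamma$. Notation: $P_c\in\mathcal L(X,Z)$ is the spectral projector associated with $\sigma_c$, $P_{su}=\mathrm{id}_X-P_c$, $E_c=\mathrm{range}\,P_c\subset Z$, $X_{su}=P_{su}X$, $Y_{su}=P_{su}Y$, $Z_{su}=P_{su}Z$, and $L_{su}$ is the restriction of $L$ to $Z_{su}$. Hyperbolic linear equation assumption: for any $\eta\in[0,\gamma]$ and any $f\in C_\eta(\mathbb R,Y_{su})$ the problem $\dot u_{su}=L_{su}u_{su}+f(t)$ has a unique solution $u_{su}=K_{su}f\in C_\eta(\mathbb R,Z_{su})$; $K_{su}\in\mathcal L(C_\eta(\mathbb R,Y_{su}),C_\eta(\mathbb R,Z_{su}))$, and its operator norm is bounded by $\Pi(\eta)$ for some $\Pi\in C([0,\gamma],\mathbb R)$. Centre-manifold data: under these assumptions there exist $\Psi\in C^k(E_c\times\mathbb R^m\times\mathbb R^p\times\mathbb R,Z_{su})$ with $\Psi(0,0,0,0)=0$, $D_u\Psi(0,0,0,0)=0$ and a neighbourhood $O_u\times O_v\times O_\mu\times O_\varepsilon$ of $0\in Z\times\mathbb R^m\times\mathbb R^p\times\mathbb R$ such that for all $(\mu,\varepsilon)\in O_\mu\times O_\varepsilon$ the manifold $M_c(\mu,\varepsilon)=\{(u_c+\Psi(u_c,v,\mu,\varepsilon),v):u_c\in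 E_c,\ v\in O_v\}$ is locally invariant (a solution starting in $M_c(\mu,\varepsilon)\cap(O_u\times O_v)$ stays in $M_c(\mu,\varepsilon)$ as long as it stays in $O_u\times O_v$) and contains $(u(0),v(0))$ for every solution staying in $O_u\times O_v$ for all $t\in\mathbb R$. Such data are fixed. *)

theory Defs
  imports "HOL-Analysis.Analysis" "HOL-Complex_Analysis.Winding_Numbers"
begin

section \<open>Maps of class \<open>C^k\<close> between Banach spaces\<close>

text \<open>
  A bounded \<open>j\<close>-linear map on a linear subspace \<open>E\<close> is a function on lists of length \<open>j\<close> with
  entries in \<open>E\<close>; this is what allows an iterated derivative of arbitrary order to have a fixed type.
\<close>

definition bounded_multilinear_on ::
  "nat \<Rightarrow> 'a::real_normed_vector set \<Rightarrow> ('a list \<Rightarrow> 'b::real_normed_vector) \<Rightarrow> bool" where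
  "bounded_multilinear_on j E M \<longleftrightarrow>
     (\<forall>vs\<in>lists E. length vs = j \<longrightarrow>
        (\<forall>i<j. \<forall>a\<in>E. \<forall>b\<in>E. \<forall>r.
           M (vs[i := a + r *\<^sub>R b]) = M (vs[i := a]) + r *\<^sub>R M (vs[i := b]))) \<and>
     (\<exists>K. \<forall>vs\<in>lists E. length vs = j \<longrightarrow> norm (M vs) \<le> K * prod_list (map norm vs))"

text \<open>
  \<open>Ck_on k E S f\<close>: \<open>f\<close> is \<open>k\<close> times continuously Frechet differentiable on \<open>S\<close>, a (relatively)
  open subset of the linear subspace \<open>E\<close>.  \<open>D j x\<close> is the \<open>j\<close>-th derivative of \<open>f\<close> at \<open>x\<close>.
  Differentiability of \<open>D j\<close> and continuity of \<open>D k\<close> are with respect to the operator norm of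
  multilinear maps, i.e. uniform in the directions \<open>vs\<close>.
\<close>

definition Ck_on ::
  "nat \<Rightarrow> 'a::real_normed_vector set \<Rightarrow> 'a set \<Rightarrow> ('a \<Rightarrow> 'b::real_normed_vector) \<Rightarrow> bool" where
  "Ck_on k E S f \<longleftrightarrow>
     (\<exists>D :: nat \<Rightarrow> 'a \<Rightarrow> 'a list \<Rightarrow> 'b.
        (\<forall>x\<in>S. D 0 x [] = f x) \<and>
        (\<forall>j\<le>k. \<forall>x\<in>S. bounded_multilinear_on j E (D j x)) \<and>
        (\<forall>j<k. \<forall>x\<in>S. \<forall>e>0. \<exists>d>0. \<forall>y\<in>S. norm (y - x) < d \<longrightarrow>
           (\<forall>vs\<in>lists E. length vs = j \<longrightarrow>
              norm (D j y vs - D j x vs - D (Suc j) x ((y - x) # vs))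
                \<le> e * norm (y - x) * prod_list (map norm vs))) \<and>
        (\<forall>x\<in>S. \<forall>e>0. \<exists>d>0. \<forall>y\<in>S. norm (y - x) < d \<longrightarrow>
           (\<forall>vs\<in>lists E. length vs = k \<longrightarrow>
              norm (D k y vs - D k x vs) \<le> e * prod_list (map norm vs))))"

definition C1_curve_on :: "real set \<Rightarrow> (real \<Rightarrow> 'a::real_normed_vector) \<Rightarrow> bool" where
  "C1_curve_on I f \<longleftrightarrow>
     (\<exists>f'. (\<forall>t\<in>I. (f has_vector_derivative f' t) (at t within I)) \<and> continuous_on I f')"


section \<open>Spectral theory via complexification\<close>

text \<open>
  The complexification of a real space \<open>W\<close> is \<open>W \<times> W\<close>, where \<open>(a, b)\<close> stands for \<open>a + i b\<close>.  Its
  product norm is equivalent to the usual complexification norms.  Throughout, \<open>j\<close> is the embedding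
  of the domain \<open>Z\<close> of \<open>L\<close> into the ambient space \<open>X\<close>.
\<close>

definition cscale :: "complex \<Rightarrow> 'a \<times> 'a \<Rightarrow> 'a::real_vector \<times> 'a" where
  "cscale c w = (Re c *\<^sub>R fst w - Im c *\<^sub>R snd w, Re c *\<^sub>R snd w + Im c *\<^sub>R fst w)"

definition pencil ::
  "('z \<Rightarrow> 'x::real_vector) \<Rightarrow> ('z \<Rightarrow> 'x) \<Rightarrow> complex \<Rightarrow> 'z \<times> 'z \<Rightarrow> 'x \<times> 'x" where
  "pencil j L c w = cscale c (map_prod j j w) - map_prod L L w"

definition resolvent ::
  "('z \<Rightarrow> 'x::real_vector) \<Rightarrow> ('z \<Rightarrow> 'x) \<Rightarrow> complex \<Rightarrow> 'x \<times> 'x \<Rightarrow> 'x \<times> 'x" where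
  "resolvent j L c w = map_prod j j (inv (pencil j L c) w)"

definition resolvent_set ::
  "('z \<Rightarrow> 'x::real_normed_vector) \<Rightarrow> ('z \<Rightarrow> 'x) \<Rightarrow> complex set" where
  "resolvent_set j L = {c. bij (pencil j L c) \<and> bounded_linear (resolvent j L c)}"

definition spectrum ::
  "('z \<Rightarrow> 'x::real_normed_vector) \<Rightarrow> ('z \<Rightarrow> 'x) \<Rightarrow> complex set" where
  "spectrum j L = - resolvent_set j L"

definition spectrum_u where
  "spectrum_u j L = {c \<in> spectrum j L. Re c > 0}"

definition spectrum_c where
  "spectrum_c j L = {c \<in> spectrum j L. Re c = 0}"

definition spectrum_s where
  "spectrum_s j L = {c \<in> spectrum j L. Re c < 0}"

definition is_eigenvalue ::
  "('z::real_vector \<Rightarrow> 'x::real_vector) \<Rightarrow> ('z \<Rightarrow> 'x) \<Rightarrow> complex \<Rightarrow> bool" where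
  "is_eigenvalue j L c \<longleftrightarrow> (\<exists>w. w \<noteq> 0 \<and> pencil j L c w = 0)"

text \<open>\<open>gen_kernel j L c n\<close> is the kernel of the \<open>n\<close>-th power of \<open>c id - L\<close> on its natural domain.\<close>

primrec gen_kernel ::
  "('z::real_vector \<Rightarrow> 'x::real_vector) \<Rightarrow> ('z \<Rightarrow> 'x) \<Rightarrow> complex \<Rightarrow> nat \<Rightarrow> ('z \<times> 'z) set" where
  "gen_kernel j L c 0 = {0}"
| "gen_kernel j L c (Suc n) = {w. pencil j L c w \<in> map_prod j j ` gen_kernel j L c n}"

text \<open>
  The algebraic multiplicity is the dimension of the generalised eigenspace.  The span is a real
  one, but the real dimension is finite iff the complex one is.
\<close>

definition finite_algebraic_multiplicity ::
  "('z::real_vector \<Rightarrow> 'x::real_vector) \<Rightarrow> ('z \<Rightarrow> 'x) \<Rightarrow> complex \<Rightarrow> bool" where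
  "finite_algebraic_multiplicity j L c \<longleftrightarrow>
     (\<exists>B. finite B \<and> (\<Union>n. gen_kernel j L c n) \<subseteq> span B)"

text \<open>
  \<open>P\<close> is the projector in \<open>L(X, Z)\<close> given by the Riesz--Dunford integral
  \<open>P x = 1 / (2 pi i) \<integral> (c id - L)\<^sup>-\<^sup>1 x dc\<close> along a closed curve \<open>g\<close> in the resolvent set which
  winds once around \<open>S\<close> and not around the rest of the spectrum.  The integral of a real vector
  \<open>x = (x, 0)\<close> is computed in the complexification of \<open>X\<close>.
\<close>

definition spectral_projector ::
  "('z::real_normed_vector \<Rightarrow> 'x::real_normed_vector) \<Rightarrow> ('z \<Rightarrow> 'x) \<Rightarrow> complex set \<Rightarrow>
   ('x \<Rightarrow> 'z) \<Rightarrow> bool" where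
  "spectral_projector j L S P \<longleftrightarrow>
     bounded_linear P \<and> (\<forall>x. P (j (P x)) = P x) \<and>
     (\<exists>g. valid_path g \<and> pathfinish g = pathstart g \<and> path_image g \<subseteq> resolvent_set j L \<and>
        (\<forall>c\<in>S. winding_number g c = 1) \<and>
        (\<forall>c\<in>spectrum j L - S. winding_number g c = 0) \<and>
        (\<forall>x. ((\<lambda>t. cscale (vector_derivative g (at t within {0..1}) / (2 * of_real pi * \<i>))
                        (resolvent j L (g t) (x, 0)))
               has_integral (j (P x), 0)) {0..1}))"

definition spectral_decomposition ::
  "('z::real_normed_vector \<Rightarrow> 'x::real_normed_vector) \<Rightarrow> ('z \<Rightarrow> 'x) \<Rightarrow> real \<Rightarrow> bool" where
  "spectral_decomposition j L \<gamma> \<longleftrightarrow>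
     finite (spectrum_c j L) \<and> spectrum_c j L \<noteq> {} \<and>
     (\<forall>c\<in>spectrum_c j L. is_eigenvalue j L c \<and> finite_algebraic_multiplicity j L c) \<and>
     \<gamma> > 0 \<and>
     (INF c\<in>spectrum_u j L. ereal (Re c)) > ereal \<gamma> \<and>
     (SUP c\<in>spectrum_s j L. ereal (Re c)) < ereal (- \<gamma>)"


section \<open>The system\<close>

text \<open>
  \<open>iZ\<close> and \<open>iY\<close> are the embeddings of \<open>Z\<close> into \<open>Y\<close> and of \<open>Y\<close> into \<open>X\<close>, so that \<open>iY \<circ> iZ\<close> embeds
  \<open>Z\<close> into \<open>X\<close>.
\<close>

definition continuous_embedding :: "('a::real_normed_vector \<Rightarrow> 'b::real_normed_vector) \<Rightarrow> bool" where
  "continuous_embedding i \<longleftrightarrow> bounded_linear i \<and> inj i"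

definition vector_field_assumption ::
  "('z::real_normed_vector \<Rightarrow> 'x::real_normed_vector) \<Rightarrow> nat \<Rightarrow>
   'z set \<Rightarrow> 'v::real_normed_vector set \<Rightarrow> 'p::real_normed_vector set \<Rightarrow> real set \<Rightarrow>
   ('z \<times> 'v \<times> 'p \<times> real \<Rightarrow> 'y::real_normed_vector) \<Rightarrow> bool" where
  "vector_field_assumption L k Vu Vv Vm Ve R \<longleftrightarrow>
     bounded_linear L \<and> k \<ge> 2 \<and>
     open Vu \<and> 0 \<in> Vu \<and> open Vv \<and> 0 \<in> Vv \<and> open Vm \<and> 0 \<in> Vm \<and> open Ve \<and> 0 \<in> Ve \<and>
     Ck_on k UNIV (Vu \<times> Vv \<times> Vm \<times> Ve) R \<and>
     R (0, 0, 0, 0) = 0 \<and> ((\<lambda>u. R (u, 0, 0, 0)) has_derivative (\<lambda>h. 0)) (at 0)"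

definition vector_field ::
  "('y \<Rightarrow> 'x) \<Rightarrow> ('z \<Rightarrow> 'x) \<Rightarrow> ('z \<times> 'v \<times> 'p \<times> real \<Rightarrow> 'y) \<Rightarrow>
   'z \<times> 'v \<times> 'p \<times> real \<Rightarrow> 'x::real_vector" where
  "vector_field iY L R = (\<lambda>(u, v, \<mu>, \<epsilon>). L u + iY (R (u, v, \<mu>, \<epsilon>)))"

text \<open>\<open>R\<close> and \<open>G\<close> are only defined on \<open>V\<close>, so a solution has to take its values there.\<close>

definition solution_on ::
  "('z::real_normed_vector \<Rightarrow> 'y) \<Rightarrow> ('y \<Rightarrow> 'x::real_normed_vector) \<Rightarrow> ('z \<Rightarrow> 'x) \<Rightarrow>
   ('z \<times> 'v::real_normed_vector \<times> 'p \<times> real) set \<Rightarrow>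
   ('z \<times> 'v \<times> 'p \<times> real \<Rightarrow> 'y) \<Rightarrow> ('z \<times> 'v \<times> 'p \<times> real \<Rightarrow> 'v) \<Rightarrow>
   'p \<Rightarrow> real \<Rightarrow> real set \<Rightarrow> (real \<Rightarrow> 'z) \<Rightarrow> (real \<Rightarrow> 'v) \<Rightarrow> bool" where
  "solution_on iZ iY L V R G \<mu> \<epsilon> I u v \<longleftrightarrow>
     continuous_on I u \<and> C1_curve_on I (\<lambda>t. iY (iZ (u t))) \<and> C1_curve_on I v \<and>
     (\<forall>t\<in>I. (u t, v t, \<mu>, \<epsilon>) \<in> V \<and>
        ((\<lambda>s. iY (iZ (u s))) has_vector_derivative vector_field iY L R (u t, v t, \<mu>, \<epsilon>))
          (at t within I) \<and>
        (v has_vector_derivative \<epsilon> *\<^sub>R G (u t, v t, \<mu>, \<epsilon>)) (at t within I))"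


section \<open>Hyperbolic part\<close>

definition Z_su :: "('z \<Rightarrow> 'y) \<Rightarrow> ('y \<Rightarrow> 'x) \<Rightarrow> ('x \<Rightarrow> 'z::real_vector) \<Rightarrow> 'z set" where
  "Z_su iZ iY Pc = range (\<lambda>z. z - Pc (iY (iZ z)))"

definition Y_su :: "('z \<Rightarrow> 'y::real_vector) \<Rightarrow> ('y \<Rightarrow> 'x) \<Rightarrow> ('x \<Rightarrow> 'z) \<Rightarrow> 'y set" where
  "Y_su iZ iY Pc = range (\<lambda>y. y - iZ (Pc (iY y)))"

definition C_eta :: "real \<Rightarrow> 'a::real_normed_vector set \<Rightarrow> (real \<Rightarrow> 'a) set" where
  "C_eta \<eta> W = {f. continuous_on UNIV f \<and> range f \<subseteq> W \<and>
                   bdd_above (range (\<lambda>t. exp (- \<eta> * \<bar>t\<bar>) * norm (f t)))}"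

definition norm_eta :: "real \<Rightarrow> (real \<Rightarrow> 'a::real_normed_vector) \<Rightarrow> real" where
  "norm_eta \<eta> f = (SUP t. exp (- \<eta> * \<bar>t\<bar>) * norm (f t))"

definition linear_solution ::
  "('z::real_normed_vector \<Rightarrow> 'y) \<Rightarrow> ('y \<Rightarrow> 'x::real_normed_vector) \<Rightarrow> ('z \<Rightarrow> 'x) \<Rightarrow>
   (real \<Rightarrow> 'y) \<Rightarrow> (real \<Rightarrow> 'z) \<Rightarrow> bool" where
  "linear_solution iZ iY L f u \<longleftrightarrow>
     continuous_on UNIV u \<and> C1_curve_on UNIV (\<lambda>t. iY (iZ (u t))) \<and>
     (\<forall>t. ((\<lambda>s. iY (iZ (u s))) has_vector_derivative L (u t) + iY (f t)) (at t))"

definition hyperbolic_linear_assumption ::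
  "('z::real_normed_vector \<Rightarrow> 'y::real_normed_vector) \<Rightarrow> ('y \<Rightarrow> 'x::real_normed_vector) \<Rightarrow>
   ('z \<Rightarrow> 'x) \<Rightarrow> ('x \<Rightarrow> 'z) \<Rightarrow> real \<Rightarrow> bool" where
  "hyperbolic_linear_assumption iZ iY L Pc \<gamma> \<longleftrightarrow>
     (\<exists>K :: (real \<Rightarrow> 'y) \<Rightarrow> (real \<Rightarrow> 'z). \<exists>\<beta> :: real \<Rightarrow> real.
        continuous_on {0..\<gamma>} \<beta> \<and>
        (\<forall>\<eta>\<in>{0..\<gamma>}.
           (\<forall>f\<in>C_eta \<eta> (Y_su iZ iY Pc).
              K f \<in> C_eta \<eta> (Z_su iZ iY Pc) \<and> linear_solution iZ iY L f (K f) \<and>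
              (\<forall>u\<in>C_eta \<eta> (Z_su iZ iY Pc). linear_solution iZ iY L f u \<longrightarrow> u = K f) \<and>
              norm_eta \<eta> (K f) \<le> \<beta> \<eta> * norm_eta \<eta> f) \<and>
           (\<forall>f\<in>C_eta \<eta> (Y_su iZ iY Pc). \<forall>g\<in>C_eta \<eta> (Y_su iZ iY Pc). \<forall>a b.
              K (\<lambda>t. a *\<^sub>R f t + b *\<^sub>R g t) = (\<lambda>t. a *\<^sub>R K f t + b *\<^sub>R K g t))))"


section \<open>Centre manifold\<close>

definition center_manifold ::
  "('x \<Rightarrow> 'z::plus) \<Rightarrow> ('z \<times> 'v \<times> 'p \<times> real \<Rightarrow> 'z) \<Rightarrow> 'v set \<Rightarrow> 'p \<Rightarrow> real \<Rightarrow> ('z \<times> 'v) set" where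
  "center_manifold Pc \<Psi> Ov \<mu> \<epsilon> = {(uc + \<Psi> (uc, v, \<mu>, \<epsilon>), v) |uc v. uc \<in> range Pc \<and> v \<in> Ov}"

text \<open>
  The centre space is \<open>E\<^sub>c = range Pc\<close>; values of \<open>\<Psi>\<close> for first arguments outside of it are irrelevant.
  The sets \<open>Ou\<close>, \<open>Ov\<close>, \<open>Om\<close>, \<open>Oe\<close> are neighbourhoods of \<open>0\<close>, not necessarily open.
  Local invariance is stated for every compact time interval \<open>[0, \<tau>]\<close> on which the solution stays in
  \<open>Ou \<times> Ov\<close>.
\<close>

definition center_manifold_data ::
  "('z::real_normed_vector \<Rightarrow> 'y) \<Rightarrow> ('y \<Rightarrow> 'x::real_normed_vector) \<Rightarrow> ('z \<Rightarrow> 'x) \<Rightarrow>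
   ('z \<times> 'v::real_normed_vector \<times> 'p::real_normed_vector \<times> real) set \<Rightarrow>
   ('z \<times> 'v \<times> 'p \<times> real \<Rightarrow> 'y) \<Rightarrow> ('z \<times> 'v \<times> 'p \<times> real \<Rightarrow> 'v) \<Rightarrow>
   ('x \<Rightarrow> 'z) \<Rightarrow> nat \<Rightarrow> ('z \<times> 'v \<times> 'p \<times> real \<Rightarrow> 'z) \<Rightarrow>
   'z set \<Rightarrow> 'v set \<Rightarrow> 'p set \<Rightarrow> real set \<Rightarrow> bool" where
  "center_manifold_data iZ iY L V R G Pc k \<Psi> Ou Ov Om Oe \<longleftrightarrow>
     Ck_on k (range Pc \<times> UNIV) (range Pc \<times> UNIV) \<Psi> \<and>
     \<Psi> ` (range Pc \<times> UNIV) \<subseteq> Z_su iZ iY Pc \<and>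
     \<Psi> (0, 0, 0, 0) = 0 \<and>
     ((\<lambda>u. \<Psi> (u, 0, 0, 0)) has_derivative (\<lambda>h. 0)) (at 0 within range Pc) \<and>
     0 \<in> interior Ou \<and> 0 \<in> interior Ov \<and> 0 \<in> interior Om \<and> 0 \<in> interior Oe \<and>
     (\<forall>\<mu>\<in>Om. \<forall>\<epsilon>\<in>Oe.
        (\<forall>\<tau>>0. \<forall>u v. solution_on iZ iY L V R G \<mu> \<epsilon> {0..\<tau>} u v \<longrightarrow>
           (u 0, v 0) \<in> center_manifold Pc \<Psi> Ov \<mu> \<epsilon> \<longrightarrow>
           (\<forall>t\<in>{0..\<tau>}. (u t, v t) \<in> Ou \<times> Ov) \<longrightarrow>
           (\<forall>t\<in>{0..\<tau>}. (u t, v t) \<in> center_manifold Pc \<Psi> Ov \<mu> \<epsilon>)) \<and>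
        (\<forall>u v. solution_on iZ iY L V R G \<mu> \<epsilon> UNIV u v \<longrightarrow>
           (\<forall>t. (u t, v t) \<in> Ou \<times> Ov) \<longrightarrow>
           (u 0, v 0) \<in> center_manifold Pc \<Psi> Ov \<mu> \<epsilon>))"

end

theory Submission
  imports Defs
begin

text \<open>
  The reduced equation is the image of the full one under the centre projector.  Applying \<open>Pc\<close> to a
  point \<open>uc + \<Psi> (uc, v, \<mu>, \<epsilon>)\<close> of the centre manifold returns \<open>uc\<close>, because \<open>Pc\<close> is the identity on
  its range and vanishes on \<open>Z_su\<close>, where \<open>\<Psi>\<close> takes its values.  So the centre coordinate of a
  solution \<open>u\<close> can only be \<open>t \<mapsto> Pc (u t)\<close>, with \<open>u t\<close> viewed in \<open>X\<close>.  Although \<open>u\<close> itself is merely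
  continuous as a curve in \<open>Z\<close>, it is \<open>C\<^sup>1\<close> in \<open>X\<close>; since \<open>Pc\<close> is bounded from \<open>X\<close> to \<open>Z\<close>, it turns
  the derivative in \<open>X\<close> into a derivative in \<open>Z\<close>.  Thus \<open>Pc\<close> can be applied to both sides of the
  first equation, and the second one needs only the substitution of \<open>u\<close> by its graph representation.
\<close>

lemma C1_curve_on_bounded_linear:
  assumes "bounded_linear P" and "C1_curve_on I f"
  shows "C1_curve_on I (\<lambda>t. P (f t))"
proof -
  from assms(2) obtain f' where "\<forall>t\<in>I. (f has_vector_derivative f' t) (at t within I)"
    and "continuous_on I f'"
    unfolding C1_curve_on_def by blast
  with assms(1) have "\<forall>t\<in>I. ((\<lambda>s. P (f s)) has_vector_derivative P (f' t)) (at t within I)"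
    and "continuous_on I (\<lambda>t. P (f' t))"
    by (auto intro: bounded_linear.has_vector_derivative bounded_linear.continuous_on)
  then show ?thesis
    unfolding C1_curve_on_def by (intro exI[of _ "\<lambda>t. P (f' t)"] conjI)
qed

text \<open>
  \<open>Pc\<close> maps into \<open>Z\<close>, so it can be iterated only after embedding \<open>Z\<close> into \<open>X\<close>; idempotence takes the
  form of the fourth hypothesis.  An element of \<open>Z_su\<close> is \<open>z\<close> minus its projection, and projecting
  once more cancels the two terms.
\<close>

lemma projector_vanishes_on_Z_su:
  assumes "linear iZ" and "linear iY" and "linear Pc"
    and "\<And>x. Pc (iY (iZ (Pc x))) = Pc x"
    and "w \<in> Z_su iZ iY Pc"
  shows "Pc (iY (iZ w)) = 0"
  using assms by (auto simp: Z_su_def linear_diff)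

text \<open>
  The sum of the range of \<open>Pc\<close> and \<open>Z_su\<close> is direct: the projector reads off the first summand, so a
  point of a graph over the range of \<open>Pc\<close> determines its base point.
\<close>

lemma projector_recovers_centre_part:
  assumes "linear iZ" and "linear iY" and "linear Pc"
    and "\<And>x. Pc (iY (iZ (Pc x))) = Pc x"
    and "uc \<in> range Pc" and "w \<in> Z_su iZ iY Pc"
  shows "Pc (iY (iZ (uc + w))) = uc"
  using assms projector_vanishes_on_Z_su[OF assms(1-4) assms(6)] by (auto simp: linear_add)

theorem corollary4p6:
  fixes iZ :: "'z::banach \<Rightarrow> 'y::banach" and iY :: "'y \<Rightarrow> 'x::banach"
    and L :: "'z \<Rightarrow> 'x" and Pc :: "'x \<Rightarrow> 'z"
    and R :: "'z \<times> (real^'m) \<times> (real^'p) \<times> real \<Rightarrow> 'y"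
    and G :: "'z \<times> (real^'m) \<times> (real^'p) \<times> real \<Rightarrow> real^'m"
    and \<Psi> :: "'z \<times> (real^'m) \<times> (real^'p) \<times> real \<Rightarrow> 'z"
    and Vu Ou :: "'z set" and Vv Ov :: "(real^'m) set"
    and Vm Om :: "(real^'p) set" and Ve Oe :: "real set"
    and k :: nat and \<gamma> T \<epsilon> :: real and \<mu> :: "real^'p"
    and u :: "real \<Rightarrow> 'z" and v :: "real \<Rightarrow> real^'m"
  assumes "continuous_embedding iZ" and "continuous_embedding iY"
    and "vector_field_assumption L k Vu Vv Vm Ve R"
    and "Ck_on k UNIV (Vu \<times> Vv \<times> Vm \<times> Ve) G"
    and "spectral_decomposition (iY \<circ> iZ) L \<gamma>"
    and "spectral_projector (iY \<circ> iZ) L (spectrum_c (iY \<circ> iZ) L) Pc"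
    and "hyperbolic_linear_assumption iZ iY L Pc \<gamma>"
    and "center_manifold_data iZ iY L (Vu \<times> Vv \<times> Vm \<times> Ve) R G Pc k \<Psi> Ou Ov Om Oe"
    and "T > 0" and "\<mu> \<in> Om" and "\<epsilon> \<in> Oe"
    and "solution_on iZ iY L (Vu \<times> Vv \<times> Vm \<times> Ve) R G \<mu> \<epsilon> {0..T} u v"
    and "\<forall>t\<in>{0..T}. (u t, v t) \<in> center_manifold Pc \<Psi> Ov \<mu> \<epsilon>"
  shows "\<exists>uc :: real \<Rightarrow> 'z. C1_curve_on {0..T} uc \<and>
    (\<forall>t\<in>{0..T}. uc t \<in> range Pc \<and> u t = uc t + \<Psi> (uc t, v t, \<mu>, \<epsilon>) \<and>
      (uc has_vector_derivative
         Pc (vector_field iY L R (uc t + \<Psi> (uc t, v t, \<mu>, \<epsilon>), v t, \<mu>, \<epsilon>))) (at t within {0..T}) \<and>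
      (v has_vector_derivative
         \<epsilon> *\<^sub>R G (uc t + \<Psi> (uc t, v t, \<mu>, \<epsilon>), v t, \<mu>, \<epsilon>)) (at t within {0..T}))"
proof -
  have lin: "linear iZ" "linear iY"
    using assms(1,2) by (simp_all add: continuous_embedding_def bounded_linear.linear)
  have bl: "bounded_linear Pc" and idem: "\<And>x. Pc (iY (iZ (Pc x))) = Pc x"
    using assms(6) by (simp_all add: spectral_projector_def)
  have Psi: "\<Psi> ` (range Pc \<times> UNIV) \<subseteq> Z_su iZ iY Pc"
    using assms(8) by (simp add: center_manifold_data_def)
  define uc where "uc t = Pc (iY (iZ (u t)))" for t
  have uc_range: "uc t \<in> range Pc" for t
    by (simp add: uc_def)
  have graph: "u t = uc t + \<Psi> (uc t, v t, \<mu>, \<epsilon>)" if "t \<in> {0..T}" for t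
  proof -
    from that assms(13) obtain a where a: "a \<in> range Pc" "u t = a + \<Psi> (a, v t, \<mu>, \<epsilon>)"
      unfolding center_manifold_def by blast
    then have "\<Psi> (a, v t, \<mu>, \<epsilon>) \<in> Z_su iZ iY Pc"
      using Psi by blast
    with a have "uc t = a"
      using projector_recovers_centre_part[OF lin bounded_linear.linear[OF bl] idem]
      by (simp add: uc_def)
    with a show ?thesis by simp
  qed
  have C1: "C1_curve_on {0..T} uc"
    using assms(12) C1_curve_on_bounded_linear[OF bl, of "{0..T}" "\<lambda>t. iY (iZ (u t))"]
    unfolding uc_def[abs_def] solution_on_def by blast
  have deriv_u: "(uc has_vector_derivative Pc (vector_field iY L R (u t, v t, \<mu>, \<epsilon>)))
      (at t within {0..T})"
    and deriv_v: "(v has_vector_derivative \<epsilon> *\<^sub>R G (u t, v t, \<mu>, \<epsilon>)) (at t within {0..T})"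
    if "t \<in> {0..T}" for t
    using that assms(12) bounded_linear.has_vector_derivative[OF bl]
    unfolding uc_def[abs_def] solution_on_def by blast+
  show ?thesis
  proof (intro exI conjI ballI)
    fix t assume t: "t \<in> {0..T}"
    show "uc t \<in> range Pc" by (fact uc_range)
    show "u t = uc t + \<Psi> (uc t, v t, \<mu>, \<epsilon>)" by (fact graph[OF t])
    show "(uc has_vector_derivative
         Pc (vector_field iY L R (uc t + \<Psi> (uc t, v t, \<mu>, \<epsilon>), v t, \<mu>, \<epsilon>))) (at t within {0..T})"
      using deriv_u[OF t] unfolding graph[OF t, symmetric] .
    show "(v has_vector_derivative
         \<epsilon> *\<^sub>R G (uc t + \<Psi> (uc t, v t, \<mu>, \<epsilon>), v t, \<mu>, \<epsilon>)) (at t within {0..T})"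
      using deriv_v[OF t] unfolding graph[OF t, symmetric] .
  qed (fact C1)
qed

end
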